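(* Let $(\mathcal{M}, t)$ and $(\mathcal{N}, t')$ be free $(3)$-magmas with generating sets $X_{\mathcal{M}}$ and $X_{\mathcal{N}}$ respectively, with $|X_{\mathcal{M}}| = |X_{\mathcal{N}}|$, let $\sigma : X_{\mathcal{M}} \to X_{\mathcal{N}}$ be any bijection, and let $\Upsilon : \mathcal{M} \to \mathcal{N}$ be the associated universal bijection map. Then $\Upsilon$ is a $(3)$-magma isomorphism.
   Context: A $(3)$-magma is a pair $(\mathcal{M}, t)$ with $\mathcal{M}$ a non-empty countable set and $t : \mathcal{M} \times \mathcal{M} \times \mathcal{M} \to \mathcal{M}$ a ternary map. A morphism from $(\mathcal{M}, t)$ to $(\mathcal{N}, t')$ is a map $\theta : \mathcal{M} \to \mathcal{N}$ with $\theta(t(m_1, m_2, m_3)) = t'(\theta(m_1), \theta(m_2), \theta(m_3))$ for all $m_1, m_2, m_3 \in \mathcal{M}$; an isomorphism is a bijective morphism. $(\mathcal{M}, t)$ is free if there exist a set $Y$ and a map $i : Y \to \mathcal{M}$ such that for every $(3)$-magma $(\mathcal{N}, t')$ and every map $\varphi : Y \to \mathcal{N}$ there exists a unique morphism $\theta : \mathcal{M} \to \mathcal{N}$ with $\varphi = \theta \circ i$; the image $i(Y)$ is called the generating set of $\mathcal{M}$. Definition of $\Upsilon$: on generators, $\Upsilon(\epsilon) = \sigma(\epsilon)$ for $\epsilon \in X_{\mathcal{M}}$. For $m \in \mathcal{M} \setminus X_{\mathcal{M}}$: (i) decompose $m$ into an expression in terms of generators $\epsilon_i \in X_{\mathcal{M}}$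 and the map $t$; (ii) in this expression replace every occurrence of each $\epsilon_i$ by $\sigma(\epsilon_i)$ and every occurrence of $t$ by $t'$, obtaining an expression $\upsilon(m)$; (iii) let $\Upsilon(m)$ be the element of $\mathcal{N}$ obtained by evaluating all maps in $\upsilon(m)$. *)

theory Defs
  imports "HOL-Library.Countable_Set" "HOL-Library.FuncSet" "HOL-Library.Equipollence"
begin

definition magma3 :: "'a set \<Rightarrow> ('a \<Rightarrow> 'a \<Rightarrow> 'a \<Rightarrow> 'a) \<Rightarrow> bool" where
  "magma3 M t \<longleftrightarrow> M \<noteq> {} \<and> countable M \<and> (\<forall>a\<in>M. \<forall>b\<in>M. \<forall>c\<in>M. t a b c \<in> M)"

definition hom3 ::
  "'a set \<Rightarrow> ('a \<Rightarrow> 'a \<Rightarrow> 'a \<Rightarrow> 'a) \<Rightarrow> 'b set \<Rightarrow> ('b \<Rightarrow> 'b \<Rightarrow> 'b \<Rightarrow> 'b) \<Rightarrow> ('a \<Rightarrow> 'b) set" where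
  "hom3 M t N t' =
     {\<theta> \<in> M \<rightarrow> N. \<forall>a\<in>M. \<forall>b\<in>M. \<forall>c\<in>M. \<theta> (t a b c) = t' (\<theta> a) (\<theta> b) (\<theta> c)}"

definition iso3 ::
  "'a set \<Rightarrow> ('a \<Rightarrow> 'a \<Rightarrow> 'a \<Rightarrow> 'a) \<Rightarrow> 'b set \<Rightarrow> ('b \<Rightarrow> 'b \<Rightarrow> 'b \<Rightarrow> 'b) \<Rightarrow> ('a \<Rightarrow> 'b) set" where
  "iso3 M t N t' = {\<theta> \<in> hom3 M t N t'. bij_betw \<theta> M N}"

text \<open>The universal property of a map \<open>i : Y \<rightarrow> M\<close>. A definition cannot quantify over the type of the
  target magma. Since (3)-magmas are countable, it suffices to let the targets range over the
  subsets of \<^typ>\<open>nat\<close>; the lemma \<open>free_via_target\<close> below recovers the property for targets in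
  every type. Maps defined on \<open>M\<close> are made unique as HOL functions by \<^term>\<open>extensional M\<close>.\<close>

definition free_via ::
  "'a set \<Rightarrow> ('a \<Rightarrow> 'a \<Rightarrow> 'a \<Rightarrow> 'a) \<Rightarrow> 'y set \<Rightarrow> ('y \<Rightarrow> 'a) \<Rightarrow> bool" where
  "free_via M t Y i \<longleftrightarrow> i \<in> Y \<rightarrow> M \<and>
     (\<forall>(N :: nat set) t' \<phi>. magma3 N t' \<and> \<phi> \<in> Y \<rightarrow> N \<longrightarrow>
        (\<exists>!\<theta>. \<theta> \<in> hom3 M t N t' \<inter> extensional M \<and> (\<forall>y\<in>Y. \<phi> y = \<theta> (i y))))"

text \<open>\<open>free_magma3 M t X\<close>: the (3)-magma \<open>(M, t)\<close> is free, with generating set \<open>X\<close>. Taking \<open>Y\<close> in the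
  type of \<open>M\<close> is no restriction, by the lemma \<open>free_magma3I\<close> below.\<close>

definition free_magma3 :: "'a set \<Rightarrow> ('a \<Rightarrow> 'a \<Rightarrow> 'a \<Rightarrow> 'a) \<Rightarrow> 'a set \<Rightarrow> bool" where
  "free_magma3 M t X \<longleftrightarrow>
     magma3 M t \<and> (\<exists>(Y :: 'a set) i. free_via M t Y i \<and> X = i ` Y)"

lemma free_via_target:
  fixes N :: "'b set"
  assumes M: "magma3 M t" and free: "free_via M t Y i"
    and N: "magma3 N t'" and \<phi>: "\<phi> \<in> Y \<rightarrow> N"
  shows "\<exists>!\<theta>. \<theta> \<in> hom3 M t N t' \<inter> extensional M \<and> (\<forall>y\<in>Y. \<phi> y = \<theta> (i y))"
proof -
  define f where "f = to_nat_on N"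
  define g where "g = from_nat_into N"
  have cN: "countable N" "N \<noteq> {}" using N by (auto simp: magma3_def)
  have gf: "g (f x) = x" if "x \<in> N" for x
    using that cN by (simp add: f_def g_def)
  have i: "i y \<in> M" if "y \<in> Y" for y using free that by (auto simp: free_via_def)
  have tM: "t a b c \<in> M" if "a \<in> M" "b \<in> M" "c \<in> M" for a b c
    using M that by (auto simp: magma3_def)
  have tN: "t' a b c \<in> N" if "a \<in> N" "b \<in> N" "c \<in> N" for a b c
    using N that by (auto simp: magma3_def)
  define s where "s a b c = f (t' (g a) (g b) (g c))" for a b c
  have mag: "magma3 (f ` N) s"
    using cN by (auto simp: magma3_def s_def gf tN)
  have "(\<lambda>y. f (\<phi> y)) \<in> Y \<rightarrow> f ` N" using \<phi> by auto
  with free mag have ex1: "\<exists>!\<theta>. \<theta> \<in> hom3 M t (f ` N) s \<inter> extensional M \<and> (\<forall>y\<in>Y. f (\<phi> y) = \<theta> (i y))"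
    unfolding free_via_def by blast
  then obtain \<theta> where \<theta>: "\<theta> \<in> hom3 M t (f ` N) s" "\<forall>y\<in>Y. f (\<phi> y) = \<theta> (i y)" by blast
  have \<theta>M: "\<theta> a \<in> f ` N" if "a \<in> M" for a using \<theta>(1) that by (auto simp: hom3_def)
  have g\<theta>: "g (\<theta> a) \<in> N" if "a \<in> M" for a using \<theta>M[OF that] gf by auto
  have hom: "\<theta> (t a b c) = s (\<theta> a) (\<theta> b) (\<theta> c)" if "a \<in> M" "b \<in> M" "c \<in> M" for a b c
    using \<theta>(1) that by (auto simp: hom3_def)
  show ?thesis
  proof (rule ex_ex1I)
    have "restrict (\<lambda>m. g (\<theta> m)) M \<in> hom3 M t N t' \<inter> extensional M"
      by (auto simp: hom3_def tM hom s_def gf g\<theta> tN)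
    moreover have "\<forall>y\<in>Y. \<phi> y = restrict (\<lambda>m. g (\<theta> m)) M (i y)"
      using \<theta>(2) \<phi> by (auto simp: i gf Pi_iff simp flip: \<theta>(2))
    ultimately show "\<exists>\<theta>. \<theta> \<in> hom3 M t N t' \<inter> extensional M \<and> (\<forall>y\<in>Y. \<phi> y = \<theta> (i y))" by blast
  next
    fix p q
    assume p: "p \<in> hom3 M t N t' \<inter> extensional M \<and> (\<forall>y\<in>Y. \<phi> y = p (i y))"
      and q: "q \<in> hom3 M t N t' \<inter> extensional M \<and> (\<forall>y\<in>Y. \<phi> y = q (i y))"
    have lift: "restrict (\<lambda>m. f (r m)) M \<in> hom3 M t (f ` N) s \<inter> extensional M \<and>
        (\<forall>y\<in>Y. f (\<phi> y) = restrict (\<lambda>m. f (r m)) M (i y))"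
      if r: "r \<in> hom3 M t N t' \<inter> extensional M \<and> (\<forall>y\<in>Y. \<phi> y = r (i y))" for r
    proof -
      have rM: "r a \<in> N" if "a \<in> M" for a using r that by (auto simp: hom3_def)
      have "r (t a b c) = t' (r a) (r b) (r c)" if "a \<in> M" "b \<in> M" "c \<in> M" for a b c
        using r that by (auto simp: hom3_def)
      then show ?thesis using r by (auto simp: hom3_def tM s_def gf rM i)
    qed
    have eq: "restrict (\<lambda>m. f (p m)) M = restrict (\<lambda>m. f (q m)) M"
      using ex1 lift[OF p] lift[OF q] by blast
    show "p = q"
    proof (rule extensionalityI[of _ M])
      fix m assume m: "m \<in> M"
      then have "f (p m) = f (q m)" using fun_cong[OF eq, of m] by simp
      moreover have "p m \<in> N" "q m \<in> N" using p q m by (auto simp: hom3_def)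
      ultimately show "p m = q m" using gf by metis
    qed (use p q in auto)
  qed
qed

lemma free_magma3I:
  fixes Y :: "'y set"
  assumes M: "magma3 M t" and free: "free_via M t Y i"
  shows "free_magma3 M t (i ` Y)"
proof -
  have "free_via M t (i ` Y) (\<lambda>x. x)"
    unfolding free_via_def
  proof (intro conjI allI impI)
    show "(\<lambda>x. x) \<in> i ` Y \<rightarrow> M" using free by (auto simp: free_via_def)
  next
    fix N :: "nat set" and t' \<phi>
    assume "magma3 N t' \<and> \<phi> \<in> i ` Y \<rightarrow> N"
    then have "magma3 N t'" "(\<lambda>y. \<phi> (i y)) \<in> Y \<rightarrow> N" by auto
    with free have "\<exists>!\<theta>. \<theta> \<in> hom3 M t N t' \<inter> extensional M \<and> (\<forall>y\<in>Y. \<phi> (i y) = \<theta> (i y))"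
      unfolding free_via_def by blast
    then show "\<exists>!\<theta>. \<theta> \<in> hom3 M t N t' \<inter> extensional M \<and> (\<forall>x\<in>i ` Y. \<phi> x = \<theta> x)" by simp
  qed
  then show ?thesis using M unfolding free_magma3_def by (metis image_ident)
qed

text \<open>Formal expressions in a ternary operation symbol, with atoms in \<open>'a\<close>.\<close>

datatype (atoms: 'a) expr3 = Atom 'a | Op "'a expr3" "'a expr3" "'a expr3"

primrec eval3 :: "('a \<Rightarrow> 'a \<Rightarrow> 'a \<Rightarrow> 'a) \<Rightarrow> 'a expr3 \<Rightarrow> 'a" where
  "eval3 t (Atom x) = x"
| "eval3 t (Op e1 e2 e3) = t (eval3 t e1) (eval3 t e2) (eval3 t e3)"

text \<open>Meaningful for \<open>m \<in> M\<close> when \<open>free_magma3 M t X\<close>: only then is the expression of \<open>m\<close> in terms of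
  \<open>X\<close> guaranteed to exist and to be unique.\<close>

definition decompose3 :: "('a \<Rightarrow> 'a \<Rightarrow> 'a \<Rightarrow> 'a) \<Rightarrow> 'a set \<Rightarrow> 'a \<Rightarrow> 'a expr3" where
  "decompose3 t X m = (THE e. atoms e \<subseteq> X \<and> eval3 t e = m)"

text \<open>Replacing the atoms by their images under \<open>\<sigma>\<close> is \<^term>\<open>map_expr3 \<sigma>\<close>; replacing \<open>t\<close> by \<open>t'\<close> amounts
  to interpreting the operation symbol \<^const>\<open>Op\<close> by \<open>t'\<close>. Values outside \<open>M\<close> are irrelevant.\<close>

definition universal_bij ::
  "('a \<Rightarrow> 'a \<Rightarrow> 'a \<Rightarrow> 'a) \<Rightarrow> 'a set \<Rightarrow> ('b \<Rightarrow> 'b \<Rightarrow> 'b \<Rightarrow> 'b) \<Rightarrow> ('a \<Rightarrow> 'b) \<Rightarrow> 'a \<Rightarrow> 'b" where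
  "universal_bij t X t' \<sigma> m =
     (if m \<in> X then \<sigma> m else eval3 t' (map_expr3 \<sigma> (decompose3 t X m)))"

end

theory Submission imports Defs begin

text \<open>
  A free (3)-magma is a term algebra: if \<open>X\<close> is the generating set of \<open>M\<close>, then evaluation is a
  bijection from the expressions with atoms in \<open>X\<close> onto \<open>M\<close> (\<open>free_magma3_eval_bij\<close>). Both halves
  come from the universal property, applied to two well-chosen target magmas.

  Surjectivity uses the uniqueness of morphisms. If the elements that expressions evaluate to formed
  a proper subset \<open>S\<close> of \<open>M\<close>, then one could split the elements outside \<open>S\<close> in two and map \<open>M\<close> into
  the resulting magma in two ways that agree on the generators (\<open>free_via_generates\<close>).

  Injectivity uses the existence of a morphism. The expressions over \<open>X\<close> form a countable magma,
  and the morphism that sends each generator to itself as an atom recovers an expression from its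
  value (\<open>free_via_eval_inj\<close>).

  Hence decomposition into generators is the inverse of evaluation, so that \<open>\<Upsilon>\<close> is a composition of
  three bijections: decompose in \<open>M\<close>, rename the atoms by \<open>\<sigma>\<close>, evaluate in \<open>N\<close>. Each of them
  carries the operation of its domain to that of its codomain.
\<close>

definition exprs_over :: "'a set \<Rightarrow> 'a expr3 set" where
  "exprs_over X = {e. atoms e \<subseteq> X}"

lemma exprs_over_simps [simp]:
  "Atom x \<in> exprs_over X \<longleftrightarrow> x \<in> X"
  "Op e1 e2 e3 \<in> exprs_over X \<longleftrightarrow> e1 \<in> exprs_over X \<and> e2 \<in> exprs_over X \<and> e3 \<in> exprs_over X"
  by (auto simp: exprs_over_def)

instance expr3 :: (countable) countable
  by countable_datatype

lemma inj_on_map_expr3: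
  assumes "inj_on f X"
  shows "inj_on (map_expr3 f) (exprs_over X)"
proof (rule inj_onI)
  fix d e assume "d \<in> exprs_over X" "e \<in> exprs_over X" "map_expr3 f d = map_expr3 f e"
  then show "d = e"
    using assms by (auto simp: exprs_over_def inj_on_def intro!: expr3.inj_map_strong[of d e f f])
qed

lemma bij_betw_map_expr3:
  assumes "bij_betw f X Y"
  shows "bij_betw (map_expr3 f) (exprs_over X) (exprs_over Y)"
proof -
  have "e \<in> map_expr3 f ` exprs_over X" if "e \<in> exprs_over Y" for e
  proof
    show "e = map_expr3 f (map_expr3 (inv_into X f) e)"
      using that assms
      by (auto simp: expr3.map_comp exprs_over_def bij_betw_def f_inv_into_f subset_iff
          intro!: expr3.map_ident_strong[symmetric])
    show "map_expr3 (inv_into X f) e \<in> exprs_over X"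
      using that assms by (auto simp: exprs_over_def expr3.set_map bij_betw_def inv_into_into)
  qed
  moreover have "map_expr3 f ` exprs_over X \<subseteq> exprs_over Y"
    using assms by (fastforce simp: exprs_over_def expr3.set_map bij_betw_def)
  ultimately show ?thesis
    using assms inj_on_map_expr3 by (auto simp: bij_betw_def)
qed

text \<open>Numbering the atoms embeds the expressions over a countable set into the countable type
  \<^typ>\<open>nat expr3\<close>.\<close>

lemma countable_exprs_over:
  assumes "countable X"
  shows "countable (exprs_over X)"
  using inj_on_map_expr3[OF inj_on_to_nat_on[OF assms]]
  by (rule countable_image_inj_on[rotated]) simp

lemma eval3_in_carrier:
  assumes "magma3 M t" "X \<subseteq> M" "e \<in> exprs_over X"
  shows "eval3 t e \<in> M"
  using assms(3) by (induction e) (use assms(1,2) in \<open>auto simp: magma3_def\<close>)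

text \<open>Tag the elements of \<open>M\<close> with a Boolean, and let the operation keep a tag \<^const>\<open>True\<close> only as
  long as the result lies outside the subset \<open>S\<close> generated by the expressions. Then tagging every
  element with \<^const>\<open>False\<close> and tagging exactly the elements outside \<open>S\<close> with \<^const>\<open>True\<close> are two
  morphisms that agree on the generators, hence everywhere. The argument also covers an empty \<open>Y\<close>:
  there it makes \<open>M\<close> empty, which shows that no (3)-magma is free on the empty set.\<close>

lemma free_via_generates:
  assumes M: "magma3 M t" and free: "free_via M t Y i"
  shows "eval3 t ` exprs_over (i ` Y) = M"
proof -
  define S where "S = eval3 t ` exprs_over (i ` Y)"
  define u where "u = (\<lambda>(a, x) (b, y) (c, z). (t a b c, (x \<or> y \<or> z) \<and> t a b c \<notin> S))"
  have iM: "i y \<in> M" if "y \<in> Y" for y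
    using free that by (auto simp: free_via_def)
  have iS: "i y \<in> S" if "y \<in> Y" for y
    using that unfolding S_def by (intro image_eqI[of _ _ "Atom (i y)"]) auto
  have tM: "t a b c \<in> M" if "a \<in> M" "b \<in> M" "c \<in> M" for a b c
    using M that by (auto simp: magma3_def)
  have tS: "t a b c \<in> S" if "a \<in> S" "b \<in> S" "c \<in> S" for a b c
  proof -
    from that obtain d e f where
      "d \<in> exprs_over (i ` Y)" "e \<in> exprs_over (i ` Y)" "f \<in> exprs_over (i ` Y)"
      "a = eval3 t d" "b = eval3 t e" "c = eval3 t f"
      unfolding S_def by blast
    then show ?thesis
      unfolding S_def by (intro image_eqI[of _ _ "Op d e f"]) auto
  qed
  have "magma3 (M \<times> (UNIV :: bool set)) u"
    using M by (auto simp: magma3_def u_def)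
  moreover have "(\<lambda>y. (i y, False)) \<in> Y \<rightarrow> M \<times> UNIV"
    using iM by auto
  ultimately have ex1: "\<exists>!\<theta>. \<theta> \<in> hom3 M t (M \<times> UNIV) u \<inter> extensional M \<and>
      (\<forall>y\<in>Y. (i y, False) = \<theta> (i y))"
    by (rule free_via_target[OF M free])
  let ?p = "restrict (\<lambda>m. (m, False)) M"
  let ?q = "restrict (\<lambda>m. (m, m \<notin> S)) M"
  have "?p \<in> hom3 M t (M \<times> UNIV) u \<inter> extensional M \<and> (\<forall>y\<in>Y. (i y, False) = ?p (i y))"
    by (auto simp: hom3_def u_def tM iM)
  moreover have "?q \<in> hom3 M t (M \<times> UNIV) u \<inter> extensional M \<and> (\<forall>y\<in>Y. (i y, False) = ?q (i y))"
    by (auto simp: hom3_def u_def tM iM iS tS)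
  ultimately have eq: "?p = ?q"
    using ex1 by blast
  have "M \<subseteq> S"
  proof
    fix m assume "m \<in> M"
    then show "m \<in> S" using fun_cong[OF eq, of m] by simp
  qed
  moreover have "S \<subseteq> M"
    using eval3_in_carrier[OF M, of "i ` Y"] iM by (auto simp: S_def)
  ultimately show ?thesis
    by (auto simp: S_def)
qed

text \<open>The morphism into the magma of expressions that extends \<^const>\<open>Atom\<close> is a left inverse of
  evaluation.\<close>

lemma free_via_eval_inj:
  assumes M: "magma3 M t" and free: "free_via M t Y i"
  shows "inj_on (eval3 t) (exprs_over (i ` Y))"
proof -
  let ?X = "i ` Y"
  have XM: "?X \<subseteq> M"
    using free by (auto simp: free_via_def)
  then have "countable ?X"
    using M by (meson countable_subset magma3_def)
  \<comment> \<open>A (3)-magma must be nonempty; there are expressions because \<open>M\<close> is nonempty and generated.\<close>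
  moreover have "exprs_over ?X \<noteq> {}"
    using free_via_generates[OF M free] M by (auto simp: magma3_def)
  ultimately have "magma3 (exprs_over ?X) Op"
    by (auto simp: magma3_def countable_exprs_over)
  moreover have "(\<lambda>y. Atom (i y)) \<in> Y \<rightarrow> exprs_over ?X"
    by auto
  ultimately obtain \<theta> where \<theta>: "\<theta> \<in> hom3 M t (exprs_over ?X) Op" "\<forall>y\<in>Y. Atom (i y) = \<theta> (i y)"
    using free_via_target[OF M free] by blast
  have "\<theta> (eval3 t e) = e" if "e \<in> exprs_over ?X" for e
    using that
  proof (induction e)
    case (Atom x)
    then show ?case using \<theta>(2) by auto
  next
    case (Op e1 e2 e3)
    then show ?case
      using \<theta>(1) eval3_in_carrier[OF M XM] by (auto simp: hom3_def)
  qed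
  then show ?thesis
    by (rule inj_on_inverseI)
qed

lemma free_magma3_eval_bij:
  assumes "free_magma3 M t X"
  shows "bij_betw (eval3 t) (exprs_over X) M"
  using assms free_via_generates free_via_eval_inj
  unfolding free_magma3_def bij_betw_def by blast

lemma decompose3_eval3:
  assumes "free_magma3 M t X" "e \<in> exprs_over X"
  shows "decompose3 t X (eval3 t e) = e"
  unfolding decompose3_def
  using assms(2) bij_betw_imp_inj_on[OF free_magma3_eval_bij[OF assms(1)]]
  by (intro the_equality) (auto simp: exprs_over_def inj_on_def)

text \<open>A generator decomposes into itself as an atom, so the two branches in the definition of \<open>\<Upsilon>\<close>
  agree. Every element of \<open>M\<close> has the form \<^term>\<open>eval3 t e\<close>, so this equation determines \<open>\<Upsilon>\<close>
  on \<open>M\<close>.\<close>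

lemma universal_bij_eval3:
  assumes free: "free_magma3 M t X" and e: "e \<in> exprs_over X"
  shows "universal_bij t X t' \<sigma> (eval3 t e) = eval3 t' (map_expr3 \<sigma> e)"
proof (cases "eval3 t e \<in> X")
  case True
  then have "decompose3 t X (eval3 t e) = Atom (eval3 t e)"
    using decompose3_eval3[OF free, of "Atom (eval3 t e)"] by simp
  then have "e = Atom (eval3 t e)"
    using decompose3_eval3[OF free e] by simp
  then obtain x where "e = Atom x" ..
  then show ?thesis
    using True by (simp add: universal_bij_def)
next
  case False
  then show ?thesis
    by (simp add: universal_bij_def decompose3_eval3[OF free e])
qed

theorem proposition15:
  fixes M :: "'a set" and t :: "'a \<Rightarrow> 'a \<Rightarrow> 'a \<Rightarrow> 'a"
    and N :: "'b set" and t' :: "'b \<Rightarrow> 'b \<Rightarrow> 'b \<Rightarrow> 'b"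
    and X\<^sub>M :: "'a set" and X\<^sub>N :: "'b set" and \<sigma> :: "'a \<Rightarrow> 'b"
  assumes "free_magma3 M t X\<^sub>M"
    and "free_magma3 N t' X\<^sub>N"
    and "X\<^sub>M \<approx> X\<^sub>N"
    and "bij_betw \<sigma> X\<^sub>M X\<^sub>N"
  shows "universal_bij t X\<^sub>M t' \<sigma> \<in> iso3 M t N t'"
proof -
  let ?U = "universal_bij t X\<^sub>M t' \<sigma>"
  note evalM = free_magma3_eval_bij[OF assms(1)]
  note U_eval = universal_bij_eval3[OF assms(1), of _ t' \<sigma>]
  have "bij_betw (eval3 t' \<circ> map_expr3 \<sigma>) (exprs_over X\<^sub>M) N"
    using bij_betw_map_expr3[OF assms(4)] free_magma3_eval_bij[OF assms(2)]
    by (rule bij_betw_trans)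
  then have "bij_betw (?U \<circ> eval3 t) (exprs_over X\<^sub>M) N"
    by (rule bij_betw_cong[THEN iffD1, rotated]) (simp add: U_eval)
  then have bij: "bij_betw ?U M N"
    using bij_betw_comp_iff[OF evalM] by blast
  have "?U (t a b c) = t' (?U a) (?U b) (?U c)" if abc: "a \<in> M" "b \<in> M" "c \<in> M" for a b c
  proof -
    have "M = eval3 t ` exprs_over X\<^sub>M"
      using evalM by (simp add: bij_betw_def)
    with abc obtain d e f where
      def: "d \<in> exprs_over X\<^sub>M" "e \<in> exprs_over X\<^sub>M" "f \<in> exprs_over X\<^sub>M"
      and abc_eq: "a = eval3 t d" "b = eval3 t e" "c = eval3 t f"
      by blast
    have "?U (t a b c) = ?U (eval3 t (Op d e f))"
      by (simp add: abc_eq)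
    also have "\<dots> = eval3 t' (map_expr3 \<sigma> (Op d e f))"
      by (rule U_eval) (simp add: def)
    also have "\<dots> = t' (?U a) (?U b) (?U c)"
      by (simp add: abc_eq U_eval def)
    finally show ?thesis .
  qed
  then show ?thesis
    using bij by (auto simp: iso3_def hom3_def bij_betw_def)
qed

end
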